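(* Let $A,B\in\mathbb{Q}$ with $AB\neq 0$. If $x^7+Ax+B$ has reducibility type $(1,2,4)$, then, up to scaling, there are $v,w\in\mathbb{Q}$ such that $$A=w^3-v(3v+1)w^2+v(v^3+3v^2-2v+1)w-v(v^4-v^3+v^2-v+1),$$ $$B=-w\bigl(w^2-(3v^2-2v+1)w+(v^4-v^3+v^2-v+1)\bigr),$$ and $$4v^6-8v^5+9v^4-4v^3-6v^2+12v-3=\bigl(4v^3-3v^2+2v-1-2(3v-1)w\bigr)^2.$$
   Context: A monic polynomial in $\mathbb{Q}[x]$ has reducibility type $(n_1,\dots,n_k)$, $n_1\le\dots\le n_k$, if it factors as a product of $k$ irreducible polynomials in $\mathbb{Q}[x]$ (not necessarily distinct) of degrees $n_1,\dots,n_k$. Trinomials are considered up to scaling: $x^n+Ax^m+B$ and $x^n+A\lambda^{n-m}x^m+B\lambda^n$ are identified for $\lambda\in\mathbb{Q}\setminus\{0\}$; "up to scaling $(A,B)=(A_0,B_0)$" means $(A,B)=(A_0\lambda^{n-m},B_0\lambda^n)$ for some $\lambda\in\mathbb{Q}\setminus\{0\}$. *)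

theory Defs
  imports "HOL-Computational_Algebra.Computational_Algebra"
begin

definition trinomial :: "nat \<Rightarrow> nat \<Rightarrow> rat \<Rightarrow> rat \<Rightarrow> rat poly" where
  "trinomial n m A B = monom 1 n + monom A m + [:B:]"

text \<open>The list \<open>ps\<close> of factors may contain repetitions; the factors need not be monic,
  which does not affect their degrees.\<close>

definition has_reducibility_type :: "rat poly \<Rightarrow> nat list \<Rightarrow> bool" where
  "has_reducibility_type f ns \<longleftrightarrow>
     lead_coeff f = 1 \<and> sorted ns \<and>
     (\<exists>ps. f = prod_list ps \<and> (\<forall>p\<in>set ps. irreducible p) \<and> map degree ps = ns)"

text \<open>\<open>equal_up_to_scaling n m (A, B) (A0, B0)\<close>: the trinomial with coefficients \<open>(A, B)\<close> arises
  from the one with coefficients \<open>(A0, B0)\<close> by the substitution \<open>x \<mapsto> x / c\<close>, multiplied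
  by \<open>c ^ n\<close> to make it monic again. It is meant for \<open>m < n\<close>.\<close>

definition equal_up_to_scaling :: "nat \<Rightarrow> nat \<Rightarrow> rat \<times> rat \<Rightarrow> rat \<times> rat \<Rightarrow> bool" where
  "equal_up_to_scaling n m P Q \<longleftrightarrow>
     (\<exists>c. c \<noteq> 0 \<and> fst P = fst Q * c ^ (n - m) \<and> snd P = snd Q * c ^ n)"

end

theory Submission
  imports Defs
begin

text \<open>Scale the rational root to \<open>1\<close> and let \<open>x\<^sup>2 + v x + w\<close> be the quadratic factor. The vanishing of
  the coefficients of \<open>x\<^sup>6, \<dots>, x\<^sup>3\<close> determines the quartic factor, the coefficients of \<open>x\<close> and \<open>1\<close> give
  \<open>A\<close> and \<open>B\<close>, and the vanishing of the coefficient of \<open>x\<^sup>2\<close> is quadratic in \<open>w\<close> with leading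
  coefficient \<open>3 v - 1\<close>; completing the square yields the curve.\<close>

lemma poly_eq_of_degree_1:
  fixes p :: "'a::comm_semiring_0 poly"
  assumes "degree p = 1"
  shows "p = [:coeff p 0, coeff p 1:]"
  using assms by (intro poly_eqI) (auto simp: coeff_pCons coeff_eq_0 split: nat.splits)

lemma poly_eq_of_degree_2:
  fixes p :: "'a::comm_semiring_0 poly"
  assumes "degree p = 2"
  shows "p = [:coeff p 0, coeff p 1, coeff p 2:]"
  using assms
  by (intro poly_eqI) (auto simp: coeff_pCons coeff_eq_0 numeral_2_eq_2 split: nat.splits)

lemma poly_eq_of_degree_4:
  fixes p :: "'a::comm_semiring_0 poly"
  assumes "degree p = 4"
  shows "p = [:coeff p 0, coeff p 1, coeff p 2, coeff p 3, coeff p 4:]"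
  using assms
  by (intro poly_eqI)
    (auto simp: coeff_pCons coeff_eq_0 numeral_2_eq_2 numeral_3_eq_3 eval_nat_numeral
      split: nat.splits)

lemma trinomial_7_1_conv_pCons: "trinomial 7 1 A B = [:B, A, 0, 0, 0, 0, 0, 1:]"
  by (simp add: trinomial_def monom_altdef eval_nat_numeral)

text \<open>The leading coefficients of the three factors multiply to 1, so dividing each factor by
  its own leaves the product unchanged.\<close>

lemma trinomial_7_1_monic_factors:
  assumes "has_reducibility_type (trinomial 7 1 A B) [1, 2, 4]"
  obtains r a b c d e f where
    "trinomial 7 1 A B = [:-r, 1:] * [:b, a, 1:] * [:f, e, d, c, 1:]"
proof -
  obtain ps where fac: "trinomial 7 1 A B = prod_list ps" and deg: "map degree ps = [1, 2, 4]"
    using assms unfolding has_reducibility_type_def by (elim conjE exE)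
  obtain p q s where ps: "ps = [p, q, s]" and dp: "degree p = 1" and dq: "degree q = 2"
    and ds: "degree s = 4"
    using deg by (auto simp: map_eq_Cons_conv)
  define l m n where "l = coeff p 1" and "m = coeff q 2" and "n = coeff s 4"
  have "lead_coeff (trinomial 7 1 A B) = l * m * n"
    unfolding fac ps by (simp add: lead_coeff_mult dp dq ds l_def m_def n_def mult.assoc)
  hence lmn: "l * m * n = 1"
    using assms by (simp add: has_reducibility_type_def)
  hence nz: "l \<noteq> 0" "m \<noteq> 0" "n \<noteq> 0"
    by auto
  \<comment> \<open>The double negation matches the shape \<open>[:-r, 1:]\<close>, in which
    \<open>r\<close> is the rational root.\<close>
  have p: "p = smult l [:- (- coeff p 0 / l), 1:]"
    using nz poly_eq_of_degree_1[OF dp] by (simp add: l_def)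
  have q: "q = smult m [:coeff q 0 / m, coeff q 1 / m, 1:]"
    using nz poly_eq_of_degree_2[OF dq] by (simp add: m_def)
  have s: "s = smult n [:coeff s 0 / n, coeff s 1 / n, coeff s 2 / n, coeff s 3 / n, 1:]"
    using nz poly_eq_of_degree_4[OF ds] by (simp add: n_def)
  have smult3: "smult l P * (smult m Q * smult n S) = P * Q * S" for P Q S
    by (metis lmn mult.assoc mult_smult_left mult_smult_right smult_1_left smult_smult)
  have "trinomial 7 1 A B = p * (q * s)"
    using fac by (simp add: ps)
  also have "\<dots> = [:- (- coeff p 0 / l), 1:] * [:coeff q 0 / m, coeff q 1 / m, 1:] *
      [:coeff s 0 / n, coeff s 1 / n, coeff s 2 / n, coeff s 3 / n, 1:]"
    by (subst p, subst q, subst s) (rule smult3)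
  finally show ?thesis by (rule that)
qed

theorem theorem5p1:
  fixes A B :: rat
  assumes "A * B \<noteq> 0"
    and "has_reducibility_type (trinomial 7 1 A B) [1, 2, 4]"
  shows "\<exists>v w A0 B0 :: rat.
      equal_up_to_scaling 7 1 (A, B) (A0, B0) \<and>
      A0 = w^3 - v * (3*v + 1) * w^2 + v * (v^3 + 3*v^2 - 2*v + 1) * w
            - v * (v^4 - v^3 + v^2 - v + 1) \<and>
      B0 = - w * (w^2 - (3*v^2 - 2*v + 1) * w + (v^4 - v^3 + v^2 - v + 1)) \<and>
      4*v^6 - 8*v^5 + 9*v^4 - 4*v^3 - 6*v^2 + 12*v - 3
        = (4*v^3 - 3*v^2 + 2*v - 1 - 2 * (3*v - 1) * w)^2"
proof -
  obtain r a b c d e f where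
    fac: "trinomial 7 1 A B = [:-r, 1:] * [:b, a, 1:] * [:f, e, d, c, 1:]"
    using trinomial_7_1_monic_factors[OF assms(2)] .
  have "[:-r, 1:] * [:b, a, 1:] * [:f, e, d, c, 1:] =
      [:- r * b * f, (b - r * a) * f - r * b * e, (a - r) * f + (b - r * a) * e - r * b * d,
        f + (a - r) * e + (b - r * a) * d - r * b * c, e + (a - r) * d + (b - r * a) * c - r * b,
        d + (a - r) * c + (b - r * a), c + (a - r), 1:]"
    by (simp add: algebra_simps)
  hence "B = - r * b * f" and "A = (b - r * a) * f - r * b * e"
    and "0 = (a - r) * f + (b - r * a) * e - r * b * d"
    and "0 = f + (a - r) * e + (b - r * a) * d - r * b * c"
    and "0 = e + (a - r) * d + (b - r * a) * c - r * b"
    and "0 = d + (a - r) * c + (b - r * a)"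
    and "0 = c + (a - r)"
    using fac[unfolded trinomial_7_1_conv_pCons] by (simp_all only: pCons_eq_iff)
  note B = this(1) and A = this(2) and k2 = this(3) and k = this(4-7)
  have r: "r \<noteq> 0" using assms(1) B by auto
  \<comment> \<open>Coefficients of the quadratic factor after \<open>x\<close> is replaced by
    \<open>r * x\<close>, which moves the root to 1.\<close>
  define v w where "v = a / r" and "w = b / r^2"
  have a: "a = r * v" and b: "b = r^2 * w" using r by (simp_all add: v_def w_def)
  \<comment> \<open>Taken from the coefficient of \<open>x^6\<close> downwards, each equation is
    linear with coefficient 1 in the next unknown. The power of \<open>r\<close> is the weight of
    that unknown.\<close>
  have c: "c = r * (1 - v)"
    using k(4) unfolding a by (simp add: algebra_simps)
  have d: "d = r^2 * (1 - v + v^2 - w)"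
    using k(3) unfolding a b c by algebra
  have e: "e = r^3 * (1 - v + v^2 - v^3 + (2 * v - 1) * w)"
    using k(2) unfolding a b c d by algebra
  have f: "f = r^4 * (w^2 - (3*v^2 - 2*v + 1) * w + (v^4 - v^3 + v^2 - v + 1))"
    using k(1) unfolding a b c d e by algebra
  define A0 where "A0 = w^3 - v * (3*v + 1) * w^2 + v * (v^3 + 3*v^2 - 2*v + 1) * w
            - v * (v^4 - v^3 + v^2 - v + 1)"
  define B0 where "B0 = - w * (w^2 - (3*v^2 - 2*v + 1) * w + (v^4 - v^3 + v^2 - v + 1))"
  \<comment> \<open>\<open>A\<close> and \<open>B\<close> have weights 6 and 7, so the scaling
    factor is the root \<open>r\<close>.\<close>
  have "A = A0 * r^6" unfolding A A0_def a b e f by algebra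
  moreover have "B = B0 * r^7" unfolding B B0_def b f by algebra
  ultimately have "equal_up_to_scaling 7 1 (A, B) (A0, B0)"
    using r by (auto simp: equal_up_to_scaling_def)
  moreover have "4*v^6 - 8*v^5 + 9*v^4 - 4*v^3 - 6*v^2 + 12*v - 3
        = (4*v^3 - 3*v^2 + 2*v - 1 - 2 * (3*v - 1) * w)^2"
  proof -
    \<comment> \<open>The coefficient of \<open>x^2\<close> divided by \<open>r^5\<close>. Its three
      products come from \<open>k2\<close> with the values of \<open>f\<close>, \<open>e\<close> and
      \<open>d\<close> inserted.\<close>
    let ?h = "(v - 1) * (w^2 - (3*v^2 - 2*v + 1) * w + (v^4 - v^3 + v^2 - v + 1))
      + (w - v) * (1 - v + v^2 - v^3 + (2 * v - 1) * w) - w * (1 - v + v^2 - w)"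
    have "r^5 * ?h = 0" using k2 unfolding a b d e f by algebra
    hence "?h = 0" using r by simp
    \<comment> \<open>As a quadratic in \<open>w\<close>, \<open>?h\<close> is \<open>(3*v - 1) *
      w^2 - (4*v^3 - 3*v^2 + 2*v - 1) * w + (v^5 - v^4 + v^3 - v^2 + v - 1)\<close>. The sextic in
      \<open>v\<close> is its discriminant, and the right side minus the left is
      \<open>4 * (3*v - 1) * ?h\<close>, so no case split at \<open>v = 1/3\<close> arises.\<close>
    thus ?thesis by algebra
  qed
  ultimately show ?thesis unfolding A0_def B0_def by blast
qed

end
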